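(* Let $G$ be an abelian group, let $\Gamma,\Theta:\mathbb{Z}_2\to \mathrm{Aut}(G)$ be group homomorphisms, and let $G\rtimes_\Gamma\mathbb{Z}_2$ and $G\rtimes_\Theta\mathbb{Z}_2$ be the corresponding semidirect products. Let $A_0,\ldots,A_{m-1}$ be subsets of the Cartesian product $G\times\mathbb{Z}_2$. Suppose that, for each $0\le i\le m-1$, $\mathrm{Inv}(A_i;G\rtimes_\Gamma\mathbb{Z}_2)=\mathrm{Inv}(A_i;G\rtimes_\Theta\mathbb{Z}_2)$ (denote this set by $Z_i$) and $\Gamma_1(Z_i)=\Theta_1(Z_i)$. Let $H$ be a labelled digraph on the vertex set $\{0,1,\ldots,m-1\}$. Then $(A_0,A_1,\ldots,A_{m-1})$ is an $(n,m,l,\lambda;H)$-EDF in $G\rtimes_\Gamma\mathbb{Z}_2$ if and only if it is an $(n,m,l,\lambda;H)$-EDF in $G\rtimes_\Theta\mathbb{Z}_2$.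
   Context: For a homomorphism $\Gamma:\mathbb{Z}_2\to\mathrm{Aut}(G)$, write $\Gamma_h$ for the automorphism associated to $h\in\mathbb{Z}_2=\{0,1\}$. The semidirect product $G\rtimes_\Gamma\mathbb{Z}_2$ has underlying set the Cartesian product $G\times\mathbb{Z}_2$ and multiplication $(g_1,h_1)*_\Gamma(g_2,h_2)=(g_1\Gamma_{h_1}(g_2),h_1+h_2)$. All semidirect products of $G$ and $\mathbb{Z}_2$ thus share the same underlying set. An automorphism $f$ of $G$ is extended to the set $G\times\mathbb{Z}_2$ by $f(x,y)=(f(x),y)$; so $\Gamma_1(Z)=\{(\Gamma_1(g),h):(g,h)\in Z\}$. For a group $K$ with multiplication $*$ and subsets $X,Y\subseteq K$: $\mathrm{Inv}(X;K)$ is the set of inverses in $K$ of the elements of $X$, and $D(X,Y;K)$ is the multiset $\{x*y':x\in X,\ y'\in\mathrm{Inv}(Y;K)\}$. For a multiset $D$, $\lambda D$ denotes the multiset consisting of $\lambda$ copies of $D$. Digraph-defined EDF: let $K$ be a group of order $n$ with identity $e$, and let $(A_0,\ldots,A_{m-1})$ be an ordered collection of disjoint subsets of $K$, each of size $l$. Let $H$ be a labelled digraph on vertices $\{0,1,\ldots,m-1\}$ with set of directed edges $\overrightarrow{E}(H)$. Then $(A_0,\ldots,A_{m-1})$ is an $(n,m,l,\lambda;H)$-EDF (a digraph-defined external difference family) in $K$ if the multiset equation $\bigcup_{(i,j)\in\overrightarrow{E}(H)}D(A_j,A_i;K)=\lambda(K\setminus\{e\})$ holds, the union being a multiset union. 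*)

theory Defs
  imports
    "HOL-Algebra.Bij"
    "HOL-Algebra.Elementary_Groups"
    "HOL-Library.Multiset"
    "Graph_Theory.Pair_Digraph"
begin

definition semidirect ::
    "('a, 'c) monoid_scheme \<Rightarrow> ('b, 'd) monoid_scheme \<Rightarrow> ('b \<Rightarrow> 'a \<Rightarrow> 'a) \<Rightarrow> ('a \<times> 'b) monoid"
  where
    "semidirect G H \<phi> =
      \<lparr>carrier = carrier G \<times> carrier H,
       monoid.mult = (\<lambda>(g1, h1) (g2, h2). (g1 \<otimes>\<^bsub>G\<^esub> \<phi> h1 g2, h1 \<otimes>\<^bsub>H\<^esub> h2)),
       one = (\<one>\<^bsub>G\<^esub>, \<one>\<^bsub>H\<^esub>)\<rparr>"

abbreviation semidirect_Z2 ::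
    "('a, 'c) monoid_scheme \<Rightarrow> (int \<Rightarrow> 'a \<Rightarrow> 'a) \<Rightarrow> ('a \<times> int) monoid"
  where "semidirect_Z2 G \<phi> \<equiv> semidirect G (integer_mod_group 2) \<phi>"

definition extend_aut :: "('a \<Rightarrow> 'a) \<Rightarrow> 'a \<times> 'b \<Rightarrow> 'a \<times> 'b"
  where "extend_aut f = (\<lambda>(x, y). (f x, y))"

text \<open>
  The multiset of products \<open>x * y'\<close>, one for each pair \<open>(x, y')\<close> with \<open>x \<in> X\<close> and \<open>y'\<close> the
  inverse of an element of \<open>Y\<close>. It is meaningful for finite \<open>X\<close>, \<open>Y\<close> only, since
  \<^const>\<open>mset_set\<close> maps infinite sets to the empty multiset.
\<close>

definition diff_mset :: "('a, 'c) monoid_scheme \<Rightarrow> 'a set \<Rightarrow> 'a set \<Rightarrow> 'a multiset"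
  where "diff_mset K X Y =
    image_mset (\<lambda>(x, y'). x \<otimes>\<^bsub>K\<^esub> y') (mset_set (X \<times> (set_inv\<^bsub>K\<^esub> Y)))"

text \<open>
  Finiteness of the group is stated explicitly because \<^const>\<open>order\<close> is \<open>0\<close> for an infinite
  group. The digraph is not required to be free of loops.
\<close>

definition digraph_EDF ::
    "('a, 'c) monoid_scheme \<Rightarrow> nat \<Rightarrow> nat \<Rightarrow> nat \<Rightarrow> nat \<Rightarrow> nat pair_pre_digraph \<Rightarrow> (nat \<Rightarrow> 'a set) \<Rightarrow> bool"
  where
    "digraph_EDF K n m l lam H A \<longleftrightarrow>
      group K \<and> finite (carrier K) \<and> order K = n \<and>
      (\<forall>i<m. A i \<subseteq> carrier K \<and> card (A i) = l) \<and>
      disjoint_family_on A {..<m} \<and>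
      pair_wf_digraph H \<and> pverts H = {..<m} \<and>
      (\<Sum>(i, j)\<in>parcs H. diff_mset K (A j) (A i))
        = repeat_mset lam (mset_set (carrier K - {\<one>\<^bsub>K\<^esub>}))"

end

theory Submission
  imports Defs
begin

text \<open>
  In \<open>G \<rtimes>\<^sub>\<phi> \<int>\<^sub>2\<close> one has \<open>(g, h) * (u, v) = (g \<phi>\<^sub>h(u), h + v)\<close>, which is the product of \<open>(g, h)\<close>
  and \<open>(\<phi>\<^sub>h(u), v)\<close> in the \<^emph>\<open>direct\<close> product. Hence, for a fixed left factor \<open>x = (g, h)\<close>, the
  products \<open>x * z\<close> with \<open>z \<in> Z\<close> are obtained from the set \<open>\<phi>\<^sub>h(Z)\<close> by a multiplication in which
  \<open>\<phi>\<close> does not occur. As \<open>\<phi>\<^sub>h\<close> is injective, multiplicities are preserved, so the multiset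
  \<open>D(X, Y)\<close> is determined by \<open>X\<close> and the sets \<open>\<phi>\<^sub>h(Z)\<close>, where \<open>Z\<close> is the set of inverses of \<open>Y\<close>
  (lemma \<open>diff_mset_semidirect\<close>).

  Over \<open>\<int>\<^sub>2\<close> there are only two such sets: \<open>\<phi>\<^sub>0(Z) = Z\<close>, because \<open>\<phi>\<^sub>0\<close> is the identity, and
  \<open>\<phi>\<^sub>1(Z)\<close>. The hypotheses say that both agree for the two actions, so all the multisets
  \<open>D(A\<^sub>j, A\<^sub>i)\<close> agree. The carrier, the identity and the order of the group are the same for
  both actions, and each side of the equivalence is a statement about these data alone, once
  both structures are known to be groups.
\<close>

lemma AutoGroup_memD:
  assumes "f \<in> carrier (AutoGroup G)"
  shows "f \<in> hom G G" and "bij_betw f (carrier G) (carrier G)"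
  using assms by (auto simp: AutoGroup_def auto_def Bij_def)

lemma action_by_automorphisms:
  assumes "group G" and "group H" and \<phi>: "\<phi> \<in> hom H (AutoGroup G)"
  shows "\<And>h x. \<lbrakk>h \<in> carrier H; x \<in> carrier G\<rbrakk> \<Longrightarrow> \<phi> h x \<in> carrier G"
    and "\<And>h x y. \<lbrakk>h \<in> carrier H; x \<in> carrier G; y \<in> carrier G\<rbrakk> \<Longrightarrow>
      \<phi> h (x \<otimes>\<^bsub>G\<^esub> y) = \<phi> h x \<otimes>\<^bsub>G\<^esub> \<phi> h y"
    and "\<And>h k x. \<lbrakk>h \<in> carrier H; k \<in> carrier H; x \<in> carrier G\<rbrakk> \<Longrightarrow>
      \<phi> (h \<otimes>\<^bsub>H\<^esub> k) x = \<phi> h (\<phi> k x)"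
    and "\<And>x. x \<in> carrier G \<Longrightarrow> \<phi> \<one>\<^bsub>H\<^esub> x = x"
    and "\<And>h. h \<in> carrier H \<Longrightarrow> inj_on (\<phi> h) (carrier G)"
proof -
  have aut: "\<phi> h \<in> carrier (AutoGroup G)" if "h \<in> carrier H" for h
    using hom_carrier[OF \<phi>] that by auto
  note autD = AutoGroup_memD[OF aut]
  show "\<And>h x. \<lbrakk>h \<in> carrier H; x \<in> carrier G\<rbrakk> \<Longrightarrow> \<phi> h x \<in> carrier G"
    by (rule hom_in_carrier[OF autD(1)])
  show "\<And>h x y. \<lbrakk>h \<in> carrier H; x \<in> carrier G; y \<in> carrier G\<rbrakk> \<Longrightarrow>
      \<phi> h (x \<otimes>\<^bsub>G\<^esub> y) = \<phi> h x \<otimes>\<^bsub>G\<^esub> \<phi> h y"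
    by (rule hom_mult[OF autD(1)])
  show "\<And>h. h \<in> carrier H \<Longrightarrow> inj_on (\<phi> h) (carrier G)"
    by (rule bij_betw_imp_inj_on[OF autD(2)])
  show "\<phi> (h \<otimes>\<^bsub>H\<^esub> k) x = \<phi> h (\<phi> k x)"
    if "h \<in> carrier H" "k \<in> carrier H" "x \<in> carrier G" for h k x
    using hom_mult[OF \<phi>, of h k] aut[of h] aut[of k] that
    by (simp add: AutoGroup_def BijGroup_def auto_def compose_def)
  have "\<phi> \<one>\<^bsub>H\<^esub> = \<one>\<^bsub>AutoGroup G\<^esub>"
    using hom_one[OF \<phi> \<open>group H\<close> group.AutoGroup[OF \<open>group G\<close>]] .
  then show "\<phi> \<one>\<^bsub>H\<^esub> x = x" if "x \<in> carrier G" for x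
    using that by (simp add: AutoGroup_def BijGroup_def)
qed

lemma carrier_semidirect [simp]: "carrier (semidirect G H \<phi>) = carrier G \<times> carrier H"
  and one_semidirect [simp]: "\<one>\<^bsub>semidirect G H \<phi>\<^esub> = (\<one>\<^bsub>G\<^esub>, \<one>\<^bsub>H\<^esub>)"
  and mult_semidirect [simp]:
    "(g, h) \<otimes>\<^bsub>semidirect G H \<phi>\<^esub> (u, v) = (g \<otimes>\<^bsub>G\<^esub> \<phi> h u, h \<otimes>\<^bsub>H\<^esub> v)"
  by (simp_all add: semidirect_def)

lemma group_semidirect:
  assumes G: "group G" and H: "group H" and \<phi>: "\<phi> \<in> hom H (AutoGroup G)"
  shows "group (semidirect G H \<phi>)"
proof -
  interpret G: group G by fact
  interpret H: group H by fact
  note act = action_by_automorphisms[OF G H \<phi>]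
  show ?thesis
  proof (rule groupI)
    fix x assume "x \<in> carrier (semidirect G H \<phi>)"
    then obtain g h where x: "x = (g, h)" and g: "g \<in> carrier G" and h: "h \<in> carrier H"
      by auto
    (* The second components force h^-1; then phi_{h^-1}(g) has to be cancelled from the left. *)
    have "\<phi> (inv\<^bsub>H\<^esub> h) (inv\<^bsub>G\<^esub> g) \<otimes>\<^bsub>G\<^esub> \<phi> (inv\<^bsub>H\<^esub> h) g = \<phi> (inv\<^bsub>H\<^esub> h) \<one>\<^bsub>G\<^esub>"
      using g h by (simp flip: act(2))
    also have "\<phi> (inv\<^bsub>H\<^esub> h) \<one>\<^bsub>G\<^esub> = \<one>\<^bsub>G\<^esub>"
      using act(2)[of "inv\<^bsub>H\<^esub> h" "\<one>\<^bsub>G\<^esub>" "\<one>\<^bsub>G\<^esub>"] act(1)[of "inv\<^bsub>H\<^esub> h" "\<one>\<^bsub>G\<^esub>"] h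
      by (simp add: G.l_cancel_one')
    finally show "\<exists>y\<in>carrier (semidirect G H \<phi>). y \<otimes>\<^bsub>semidirect G H \<phi>\<^esub> x = \<one>\<^bsub>semidirect G H \<phi>\<^esub>"
      unfolding x using g h act(1)
      by (intro bexI[of _ "(\<phi> (inv\<^bsub>H\<^esub> h) (inv\<^bsub>G\<^esub> g), inv\<^bsub>H\<^esub> h)"]) auto
  qed (auto simp: act G.m_assoc H.m_assoc)
qed

text \<open>
  The left factor \<open>x\<close> is kept as a tag in the disjoint union on the right, since different \<open>x\<close>
  may give the same product. The map \<open>(x, z) \<mapsto> (x, \<phi>\<^sub>h(z))\<close>, with \<open>h\<close> the second component of
  \<open>x\<close>, is then injective, and what remains of the multiplication no longer involves \<open>\<phi>\<close>.
\<close>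

lemma diff_mset_semidirect:
  fixes G :: "('a, 'c) monoid_scheme" and H :: "('b, 'd) monoid_scheme"
  assumes G: "group G" and H: "group H" and \<phi>: "\<phi> \<in> hom H (AutoGroup G)"
    and X: "X \<subseteq> carrier G \<times> carrier H" and Y: "Y \<subseteq> carrier G \<times> carrier H"
  shows "diff_mset (semidirect G H \<phi>) X Y =
    image_mset (\<lambda>((g, h), (u, v)). (g \<otimes>\<^bsub>G\<^esub> u, h \<otimes>\<^bsub>H\<^esub> v))
      (mset_set (SIGMA x:X. extend_aut (\<phi> (snd x)) ` (set_inv\<^bsub>semidirect G H \<phi>\<^esub> Y)))"
proof -
  define Z where "Z = set_inv\<^bsub>semidirect G H \<phi>\<^esub> Y"
  define twist where "twist = (\<lambda>(x :: 'a \<times> 'b, z :: 'a \<times> 'b). (x, extend_aut (\<phi> (snd x)) z))"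
  have Z: "Z \<subseteq> carrier G \<times> carrier H"
    using group.inv_closed[OF group_semidirect[OF G H \<phi>]] Y
    by (fastforce simp: Z_def SET_INV_def)
  have "inj_on twist (X \<times> Z)"
  proof (rule inj_onI, clarsimp simp: twist_def extend_aut_def)
    fix g h u u' v
    assume "(g, h) \<in> X" "(u, v) \<in> Z" "(u', v) \<in> Z" and eq: "\<phi> h u = \<phi> h u'"
    then have "h \<in> carrier H" "u \<in> carrier G" "u' \<in> carrier G"
      using X Z by auto
    then show "u = u'"
      using eq action_by_automorphisms(5)[OF G H \<phi>] by (auto dest: inj_onD)
  qed
  moreover have "twist ` (X \<times> Z) = (SIGMA x:X. extend_aut (\<phi> (snd x)) ` Z)"
    by (force simp: twist_def)
  ultimately have "image_mset twist (mset_set (X \<times> Z)) =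
      mset_set (SIGMA x:X. extend_aut (\<phi> (snd x)) ` Z)"
    by (simp add: image_mset_mset_set)
  moreover have "(\<lambda>(x, z). x \<otimes>\<^bsub>semidirect G H \<phi>\<^esub> z) =
      (\<lambda>((g, h), (u, v)). (g \<otimes>\<^bsub>G\<^esub> u, h \<otimes>\<^bsub>H\<^esub> v)) \<circ> twist"
    by (auto simp: twist_def extend_aut_def)
  ultimately show ?thesis
    by (simp add: diff_mset_def flip: Z_def multiset.map_comp)
qed

theorem theorem4p1:
  fixes G :: "('a, 'c) monoid_scheme"
    and \<Gamma> \<Theta> :: "int \<Rightarrow> 'a \<Rightarrow> 'a"
    and A :: "nat \<Rightarrow> ('a \<times> int) set"
    and H :: "nat pair_pre_digraph"
    and n m l lam :: nat
  assumes "comm_group G"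
    and "\<Gamma> \<in> hom (integer_mod_group 2) (AutoGroup G)"
    and "\<Theta> \<in> hom (integer_mod_group 2) (AutoGroup G)"
    and "\<And>i. i < m \<Longrightarrow> A i \<subseteq> carrier G \<times> carrier (integer_mod_group 2)"
    and "\<And>i. i < m \<Longrightarrow>
      set_inv\<^bsub>semidirect_Z2 G \<Gamma>\<^esub> (A i) = set_inv\<^bsub>semidirect_Z2 G \<Theta>\<^esub> (A i)"
    and "\<And>i. i < m \<Longrightarrow>
      extend_aut (\<Gamma> 1) ` (set_inv\<^bsub>semidirect_Z2 G \<Gamma>\<^esub> (A i))
        = extend_aut (\<Theta> 1) ` (set_inv\<^bsub>semidirect_Z2 G \<Gamma>\<^esub> (A i))"
    and "pair_wf_digraph H" and "pverts H = {..<m}"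
  shows "digraph_EDF (semidirect_Z2 G \<Gamma>) n m l lam H A
    \<longleftrightarrow> digraph_EDF (semidirect_Z2 G \<Theta>) n m l lam H A"
proof -
  let ?Z2 = "integer_mod_group 2"
  have G: "group G"
    using assms(1) by (simp add: comm_group_def)
  have Z2: "group ?Z2"
    by simp
  have carrier_Z2: "carrier ?Z2 = {0, 1}"
    by (auto simp: carrier_integer_mod_group)
  have groups: "group (semidirect_Z2 G \<Gamma>)" "group (semidirect_Z2 G \<Theta>)"
    using assms(2,3) G Z2 by (simp_all add: group_semidirect)
  have images_eq: "extend_aut (\<Gamma> h) ` (set_inv\<^bsub>semidirect_Z2 G \<Gamma>\<^esub> (A i)) =
      extend_aut (\<Theta> h) ` (set_inv\<^bsub>semidirect_Z2 G \<Theta>\<^esub> (A i))"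
    if "i < m" "h \<in> carrier ?Z2" for i h
  proof (cases "h = 0")
    case True
    let ?Z = "set_inv\<^bsub>semidirect_Z2 G \<Gamma>\<^esub> (A i)"
    have "?Z \<subseteq> carrier G \<times> carrier ?Z2"
      using group.inv_closed[OF groups(1)] assms(4)[OF that(1)]
      by (fastforce simp: SET_INV_def)
    moreover have "\<Gamma> 0 x = \<Theta> 0 x" if "x \<in> carrier G" for x
      using action_by_automorphisms(4)[OF G Z2 assms(2) that]
        action_by_automorphisms(4)[OF G Z2 assms(3) that] by simp
    ultimately have "extend_aut (\<Gamma> 0) ` ?Z = extend_aut (\<Theta> 0) ` ?Z"
      by (intro image_cong) (auto simp: extend_aut_def)
    with True show ?thesis
      using assms(5)[OF that(1)] by simp
  next
    case False
    with that have "h = 1"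
      by (simp add: carrier_Z2)
    then show ?thesis
      using assms(5,6)[OF that(1)] by simp
  qed
  have diff_eq: "diff_mset (semidirect_Z2 G \<Gamma>) (A j) (A i) =
      diff_mset (semidirect_Z2 G \<Theta>) (A j) (A i)" if "i < m" "j < m" for i j
  proof -
    have "(SIGMA x:A j. extend_aut (\<Gamma> (snd x)) ` (set_inv\<^bsub>semidirect_Z2 G \<Gamma>\<^esub> (A i))) =
        (SIGMA x:A j. extend_aut (\<Theta> (snd x)) ` (set_inv\<^bsub>semidirect_Z2 G \<Theta>\<^esub> (A i)))"
    proof (intro Sigma_cong refl images_eq[OF that(1)])
      show "snd x \<in> carrier ?Z2" if "x \<in> A j" for x
        using assms(4)[OF \<open>j < m\<close>] that by auto
    qed
    then show ?thesis
      using assms(2-4) that by (simp add: diff_mset_semidirect[OF G Z2])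
  qed
  have "i < m \<and> j < m" if "(i, j) \<in> parcs H" for i j
    using pair_wf_digraph.in_arcsD1[OF assms(7) that] pair_wf_digraph.in_arcsD2[OF assms(7) that]
      assms(8) by auto
  then have "(\<Sum>(i, j)\<in>parcs H. diff_mset (semidirect_Z2 G \<Gamma>) (A j) (A i)) =
      (\<Sum>(i, j)\<in>parcs H. diff_mset (semidirect_Z2 G \<Theta>) (A j) (A i))"
    by (intro sum.cong) (auto simp: diff_eq)
  then show ?thesis
    using groups by (simp add: digraph_EDF_def order_def)
qed

end
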